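(* Consider the system $S$ (the synchronous exclusion process with $K$ types of particles on an open lattice of $N$ cells) with prescribed probabilities $\alpha$, $a_k$, $p_k$, $\beta_k$, $k=1,\dots,K$, where $a_1+\dots+a_K=1$, and let $x(t)$, $t=0,1,2,\dots$, be the corresponding Markov chain on $\{0,1,\dots,K\}^N$. The system is ergodic, i.e., for any state $(x_1,\dots,x_N)$ there exists the limit, as $t\to\infty$, of the probability that the system is in this state at time $t$ (the stationary probability of the state), and this limit does not depend on the initial state.
   Context: System $S$. There are $N$ cells with indices $1,\dots,N$, each containing at most one particle. Every particle has one of $K$ types $1,\dots,K$. A state is $x=(x_1,\dots,x_N)$, where $x_i=0$ if cell $i$ is vacant and $x_i=k$ if cell $i$ contains a particle of type $k$, $k=1,\dots,K$. Time is discrete, and $x(t)$ denotes the state at time $t=0,1,2,\dots$. The state at time $t+1$ is obtained from the state at time $t$ by the following rules, applied simultaneously and independently of one another, with vacancy of cells judged at time $t$: (i) if cell $1$ is vacant at time $t$, then with probability $\alpha$ there will be at time $t+1$ a particle in cell $1$ arriving from outside; the arriving particle is of type $k$ with probability $a_k$; (ii) if at time $t$ a particle of type $k$ is in cell $i$ and cell $i+1$ is vacant, then with probability $p_k$ this particle will be in cell $i+1$ at time $t+1$, and otherwise it stays in cell $i$, $i=1,\dots,N-1$; (iii) if at time $t$ a particle of type $k$ is in cell $N$, then with probability $\beta_k$ it leaves the system and cell $N$ is vacant at time $t+1$, and otherwise it stays in cell $N$. A particle whose next cell is occupied at time $t$ stays where it is. The numbers $\alpha,a_k,p_k,\beta_k$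 are prescribed probabilities.
   Formalization: All p_k and β_k are assumed positive, and the case where α=1 and every type with a_k>0 has β_k=1 (and p_k=1 if N≥2) is excluded; for arbitrary probabilities the claim fails, e.g. N=K=1, α=β_1=1 has period 2. *)

theory Defs
  imports "HOL-Probability.Probability" "HOL-Probability.Product_PMF"
begin

definition states :: "nat \<Rightarrow> nat \<Rightarrow> (nat \<Rightarrow> nat) set" where
  "states N K = {1..N} \<rightarrow>\<^sub>E {0..K}"

text \<open>
  The embedding below is a genuine probability mass function when the weights
  \<open>a 1, \<dots>, a K\<close> are nonnegative and sum to 1.
\<close>

definition type_pmf :: "nat \<Rightarrow> (nat \<Rightarrow> real) \<Rightarrow> nat pmf" where
  "type_pmf K a = embed_pmf (\<lambda>k. if k \<in> {1..K} then a k else 0)"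

text \<open>The value 0 means that no particle arrives; a value \<open>k \<ge> 1\<close> is the type of the arriving particle.\<close>

definition arrival_pmf :: "nat \<Rightarrow> real \<Rightarrow> (nat \<Rightarrow> real) \<Rightarrow> nat pmf" where
  "arrival_pmf K \<alpha> a =
     bind_pmf (bernoulli_pmf \<alpha>) (\<lambda>b. if b then type_pmf K a else return_pmf 0)"

definition move_prob ::
  "nat \<Rightarrow> (nat \<Rightarrow> real) \<Rightarrow> (nat \<Rightarrow> real) \<Rightarrow> (nat \<Rightarrow> nat) \<Rightarrow> nat \<Rightarrow> real" where
  "move_prob N p \<beta> x i =
     (if x i = 0 then 0
      else if i = N then \<beta> (x i)
      else if x (i + 1) = 0 then p (x i)
      else 0)"

text \<open>
  The new state when \<open>m i\<close> tells whether the particle of cell \<open>i\<close> leaves that cell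
  (to the next cell, or out of the system if \<open>i = N\<close>) and \<open>c\<close> is the arrival from outside,
  which only takes effect if cell 1 is vacant. A vacant cell \<open>i > 1\<close> receives the particle
  of cell \<open>i - 1\<close> exactly if that one moves.
\<close>

definition update :: "nat \<Rightarrow> (nat \<Rightarrow> nat) \<Rightarrow> nat \<Rightarrow> (nat \<Rightarrow> bool) \<Rightarrow> nat \<Rightarrow> nat" where
  "update N x c m =
     (\<lambda>i\<in>{1..N}.
        if x i \<noteq> 0 then (if m i then 0 else x i)
        else if i = 1 then c
        else if m (i - 1) then x (i - 1)
        else 0)"

definition step ::
  "nat \<Rightarrow> nat \<Rightarrow> real \<Rightarrow> (nat \<Rightarrow> real) \<Rightarrow> (nat \<Rightarrow> real) \<Rightarrow> (nat \<Rightarrow> real)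
     \<Rightarrow> (nat \<Rightarrow> nat) \<Rightarrow> (nat \<Rightarrow> nat) pmf" where
  "step N K \<alpha> a p \<beta> x =
     bind_pmf (arrival_pmf K \<alpha> a) (\<lambda>c.
       map_pmf (update N x c)
         (Pi_pmf {1..N} False (\<lambda>i. bernoulli_pmf (move_prob N p \<beta> x i))))"

text \<open>The law at time \<open>t\<close> of the homogeneous Markov chain with kernel \<open>M\<close> started in \<open>x\<close>.\<close>

primrec law_at :: "('s \<Rightarrow> 's pmf) \<Rightarrow> 's \<Rightarrow> nat \<Rightarrow> 's pmf" where
  "law_at M x 0 = return_pmf x"
| "law_at M x (Suc t) = bind_pmf (law_at M x t) M"

definition ergodic_chain :: "'s set \<Rightarrow> ('s \<Rightarrow> 's pmf) \<Rightarrow> bool" where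
  "ergodic_chain S M \<longleftrightarrow>
     (\<forall>y\<in>S. \<exists>l. \<forall>x\<in>S. (\<lambda>t. pmf (law_at M x t) y) \<longlonglongrightarrow> l)"

end

(* The chain is finite, so by Doeblin's argument it suffices to find a state z that is reachable
   from every state and stays put with positive probability. Since not everything is
   deterministic, some gate can be kept closed with positive probability: no arrivals, the exit
   of a particle of type k, or the move of a particle of type k out of cell N - 1. Let z be the
   state with type k in all cells up to the gate and none beyond. To reach z, let every particle
   move whenever it can, with only type k arriving (nothing, if the arrivals are the gate),
   until all other types have left; then close the gate and wait until the cells behind it
   are full and those beyond it empty. *)
theory Submission
  imports Defs
begin

section \<open>Finite chains with a reachable state that can be held\<close>

lemma law_at_add:
  "law_at M x (s + t) = bind_pmf (law_at M x s) (\<lambda>w. law_at M w t)"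
  by (induction t) (simp_all add: bind_return_pmf' bind_assoc_pmf)

lemma set_law_at_subset:
  assumes "\<And>x. x \<in> S \<Longrightarrow> set_pmf (M x) \<subseteq> S" and "x \<in> S"
  shows "set_pmf (law_at M x t) \<subseteq> S"
  using assms by (induction t) auto

lemma pmf_law_at_add:
  assumes "finite S" and closed: "\<And>x. x \<in> S \<Longrightarrow> set_pmf (M x) \<subseteq> S" and "x \<in> S"
  shows "pmf (law_at M x (s + t)) y = (\<Sum>w\<in>S. pmf (law_at M x s) w * pmf (law_at M w t) y)"
proof -
  have "pmf (law_at M x (s + t)) y
      = measure_pmf.expectation (law_at M x s) (\<lambda>w. pmf (law_at M w t) y)"
    by (simp add: law_at_add pmf_bind)
  also have "\<dots> = (\<Sum>w\<in>S. pmf (law_at M x s) w * pmf (law_at M w t) y)"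
    using integral_measure_pmf[of S "law_at M x s" "\<lambda>w. pmf (law_at M w t) y"]
      set_law_at_subset[of S M x s, OF closed \<open>x \<in> S\<close>] \<open>finite S\<close> by auto
  finally show ?thesis .
qed

text \<open>The guaranteed mass \<open>d\<close> at \<open>z\<close> contributes \<open>f z\<close>
  and the rest at most \<open>b\<close>; surplus mass at \<open>z\<close> does no harm, as
  \<open>f z \<le> b\<close>.\<close>

lemma sum_pmf_mult_le:
  fixes f :: "'s \<Rightarrow> real"
  assumes "finite S" "set_pmf q \<subseteq> S" "z \<in> S" "d \<le> pmf q z" "\<And>w. w \<in> S \<Longrightarrow> f w \<le> b"
  shows "(\<Sum>w\<in>S. pmf q w * f w) \<le> d * f z + (1 - d) * b"
proof -
  have 1: "(\<Sum>w\<in>S. pmf q w) = 1"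
    using assms by (simp add: sum_pmf_eq_1)
  have "(pmf q z) * (b - f z) \<le> (\<Sum>w\<in>S. pmf q w * (b - f w))"
    using assms by (intro member_le_sum) auto
  moreover have "d * (b - f z) \<le> pmf q z * (b - f z)"
    using assms by (intro mult_right_mono) auto
  moreover have "(\<Sum>w\<in>S. pmf q w * (b - f w)) = b - (\<Sum>w\<in>S. pmf q w * f w)"
    using 1 by (simp add: right_diff_distrib sum_subtractf flip: sum_distrib_right)
  ultimately show ?thesis by (simp add: algebra_simps)
qed

text \<open>Doeblin's argument: the oscillation over the initial states contracts by the factor
  \<open>1 - \<delta>\<close> every \<open>T\<close> steps.\<close>

lemma ergodic_chain_minorized:
  assumes "finite S" and closed: "\<And>x. x \<in> S \<Longrightarrow> set_pmf (M x) \<subseteq> S"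
    and "z \<in> S" and "0 < \<delta>"
    and minor: "\<And>x. x \<in> S \<Longrightarrow> \<delta> \<le> pmf (law_at M x T) z"
  shows "ergodic_chain S M"
  unfolding ergodic_chain_def
proof
  fix y assume "y \<in> S"
  define f where "f t x = pmf (law_at M x t) y" for t x
  define hi where "hi t = Max (f t ` S)" for t
  define lo where "lo t = Min (f t ` S)" for t
  have f_hi: "f t x \<le> hi t" and f_lo: "lo t \<le> f t x" if "x \<in> S" for t x
    using that \<open>finite S\<close> by (auto simp: hi_def lo_def)
  have hi_le: "hi t \<le> b" if "\<And>x. x \<in> S \<Longrightarrow> f t x \<le> b" for t b
    using that \<open>finite S\<close> \<open>z \<in> S\<close> unfolding hi_def by (subst Max_le_iff) auto
  have lo_ge: "b \<le> lo t" if "\<And>x. x \<in> S \<Longrightarrow> b \<le> f t x" for t b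
    using that \<open>finite S\<close> \<open>z \<in> S\<close> unfolding lo_def by (subst Min_ge_iff) auto
  have f_add: "f (s + t) x = (\<Sum>w\<in>S. pmf (law_at M x s) w * f t w)" if "x \<in> S" for s t x
    unfolding f_def using pmf_law_at_add[of S M x] \<open>finite S\<close> closed that by blast
  have f_upper: "f (s + t) x \<le> d * f t z + (1 - d) * hi t"
    if "x \<in> S" "d \<le> pmf (law_at M x s) z" for s t x d
    using f_add[of x s t] sum_pmf_mult_le[of S "law_at M x s" z d "f t" "hi t"] that f_hi \<open>finite S\<close> \<open>z \<in> S\<close>
      set_law_at_subset[of S M x s] closed
    by simp
  have f_lower: "d * f t z + (1 - d) * lo t \<le> f (s + t) x"
    if "x \<in> S" "d \<le> pmf (law_at M x s) z" for s t x d
    using f_add[of x s t] sum_pmf_mult_le[of S "law_at M x s" z d "\<lambda>w. - f t w" "- lo t"] that f_lo \<open>finite S\<close> \<open>z \<in> S\<close>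
      set_law_at_subset[of S M x s] closed
    by (simp add: sum_negf)
  \<comment> \<open>With \<open>d = 0\<close> the two bounds only say that averages stay between
    minimum and maximum.\<close>
  have hi_mono: "hi (s + t) \<le> hi t" and lo_mono: "lo t \<le> lo (s + t)" for s t
    using f_upper[of _ 0] f_lower[of _ 0] by (auto intro!: hi_le lo_ge)
  have f01: "0 \<le> f t x" "f t x \<le> 1" for t x
    by (auto simp: f_def pmf_le_1)
  have lo_hi: "lo t \<le> hi t" for t
    using f_lo f_hi \<open>z \<in> S\<close> by (meson order_trans)
  have "\<delta> \<le> 1"
    by (rule order_trans[OF minor[OF \<open>z \<in> S\<close>] pmf_le_1])
  \<comment> \<open>The bounds for maximum and minimum share the term
    \<open>\<delta> * f t z\<close>, which cancels in the difference.\<close>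
  have contract: "hi (T + t) - lo (T + t) \<le> (1 - \<delta>) * (hi t - lo t)" for t
  proof -
    have "hi (T + t) \<le> \<delta> * f t z + (1 - \<delta>) * hi t"
      using f_upper minor by (intro hi_le) auto
    moreover have "\<delta> * f t z + (1 - \<delta>) * lo t \<le> lo (T + t)"
      using f_lower minor by (intro lo_ge) auto
    ultimately show ?thesis by (simp add: algebra_simps)
  qed
  have geometric: "hi (n * T) - lo (n * T) \<le> (1 - \<delta>) ^ n" for n
  proof (induction n)
    case 0
    have "hi 0 \<le> 1" "0 \<le> lo 0"
      using f01 by (auto intro: hi_le lo_ge)
    then show ?case by simp
  next
    case (Suc n)
    have "hi (Suc n * T) - lo (Suc n * T) \<le> (1 - \<delta>) * (hi (n * T) - lo (n * T))"
      using contract[of "n * T"] by simp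
    also have "\<dots> \<le> (1 - \<delta>) * (1 - \<delta>) ^ n"
      using Suc \<open>\<delta> \<le> 1\<close> by (intro mult_left_mono) auto
    finally show ?case by simp
  qed
  have osc_null: "(\<lambda>t. hi t - lo t) \<longlonglongrightarrow> 0"
  proof (rule LIMSEQ_I)
    fix r :: real assume "0 < r"
    then obtain n where n: "(1 - \<delta>) ^ n < r"
      using real_arch_pow_inv[of r "1 - \<delta>"] \<open>0 < \<delta>\<close> by auto
    have "norm (hi t - lo t - 0) < r" if "t \<ge> n * T" for t
    proof -
      have "hi t \<le> hi (n * T)" "lo (n * T) \<le> lo t"
        using hi_mono[of "t - n * T" "n * T"] lo_mono[of "n * T" "t - n * T"] that by auto
      then show ?thesis using geometric[of n] n lo_hi[of t] by simp
    qed
    then show "\<exists>no. \<forall>t\<ge>no. norm (hi t - lo t - 0) < r" by blast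
  qed
  have "decseq hi"
    using hi_mono[of 1] by (simp add: decseq_Suc_iff)
  moreover have "0 \<le> hi t" for t
    by (rule order_trans[OF f01(1) f_hi[OF \<open>z \<in> S\<close>]])
  ultimately obtain l where hi_lim: "hi \<longlonglongrightarrow> l"
    using decseq_convergent by blast
  have lo_lim: "lo \<longlonglongrightarrow> l"
    using tendsto_diff[OF hi_lim osc_null] by simp
  have "(\<lambda>t. f t x) \<longlonglongrightarrow> l" if "x \<in> S" for x
    using f_lo[OF that] f_hi[OF that] by (intro tendsto_sandwich[OF _ _ lo_lim hi_lim]) auto
  then show "\<exists>l. \<forall>x\<in>S. (\<lambda>t. pmf (law_at M x t) y) \<longlonglongrightarrow> l"
    by (auto simp: f_def)
qed

section \<open>From reachability to a uniform lower bound\<close>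

lemma rtrancl_imp_law_at:
  assumes "(x, z) \<in> {(u, v). v \<in> set_pmf (M u)}\<^sup>*"
  shows "\<exists>n. z \<in> set_pmf (law_at M x n)"
  using assms
proof (induction rule: rtrancl_induct)
  case base
  have "x \<in> set_pmf (law_at M x 0)" by simp
  then show ?case by blast
next
  case (step u v)
  then obtain n where "u \<in> set_pmf (law_at M x n)" by blast
  with step have "v \<in> set_pmf (law_at M x (Suc n))" by auto
  then show ?case by blast
qed

text \<open>The loop lets early arrivals wait in \<open>z\<close>, so one time \<open>T\<close>
  serves all of the finitely many initial states.\<close>

lemma ergodic_chain_reachable_loop:
  assumes "finite S" and closed: "\<And>x. x \<in> S \<Longrightarrow> set_pmf (M x) \<subseteq> S"
    and "z \<in> S" and loop: "z \<in> set_pmf (M z)"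
    and reach: "\<And>x. x \<in> S \<Longrightarrow> (x, z) \<in> {(u, v). v \<in> set_pmf (M u)}\<^sup>*"
  shows "ergodic_chain S M"
proof -
  obtain n where n: "z \<in> set_pmf (law_at M x (n x))" if "x \<in> S" for x
    using rtrancl_imp_law_at[OF reach] by metis
  define T where "T = Max (n ` S)"
  have stay: "z \<in> set_pmf (law_at M x (m + t))" if "z \<in> set_pmf (law_at M x m)" for x m t
    using that loop by (induction t) auto
  have hit: "z \<in> set_pmf (law_at M x T)" if "x \<in> S" for x
  proof -
    have "n x \<le> T" using that \<open>finite S\<close> by (simp add: T_def)
    then show ?thesis using stay[OF n[OF that], of "T - n x"] by simp
  qed
  define \<delta> where "\<delta> = Min ((\<lambda>x. pmf (law_at M x T) z) ` S)"
  have "0 < \<delta>"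
    using hit \<open>finite S\<close> \<open>z \<in> S\<close> unfolding \<delta>_def
    by (subst Min_gr_iff) (auto simp: pmf_positive)
  moreover have "\<delta> \<le> pmf (law_at M x T) z" if "x \<in> S" for x
    using that \<open>finite S\<close> by (simp add: \<delta>_def)
  ultimately show ?thesis
    using ergodic_chain_minorized[of S M z \<delta> T] \<open>finite S\<close> closed \<open>z \<in> S\<close> by blast
qed

section \<open>Possible transitions of the exclusion process\<close>

lemma set_type_pmf:
  assumes "\<And>k. k \<in> {1..K} \<Longrightarrow> 0 \<le> a k" and "(\<Sum>k=1..K. a k) = 1"
  shows "set_pmf (type_pmf K a) = {k \<in> {1..K}. 0 < a k}"
proof -
  let ?f = "\<lambda>k. if k \<in> {1..K} then a k else 0"
  have "(\<integral>\<^sup>+ k. ennreal (?f k) \<partial>count_space UNIV) = (\<Sum>k\<in>{1..K}. ennreal (?f k))"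
    by (rule nn_integral_count_space'[of "{1..K}"]) auto
  also have "\<dots> = ennreal (\<Sum>k\<in>{1..K}. ?f k)"
    using assms by (intro sum_ennreal) auto
  also have "\<dots> = 1" using assms by simp
  finally have "set_pmf (type_pmf K a) = {k. ?f k \<noteq> 0}"
    unfolding type_pmf_def using assms by (intro set_embed_pmf) auto
  then show ?thesis using assms(1) by (force simp: less_le)
qed

lemma set_bernoulli_pmf_iff:
  assumes "0 \<le> q" "q \<le> 1"
  shows "b \<in> set_pmf (bernoulli_pmf q) \<longleftrightarrow> (if b then 0 < q else q < 1)"
  using assms by (auto simp: set_pmf_iff)

locale exclusion_process =
  fixes N K :: nat and \<alpha> :: real and a p \<beta> :: "nat \<Rightarrow> real"
  assumes N_pos: "1 \<le> N"
    and \<alpha>_nonneg: "0 \<le> \<alpha>" and \<alpha>_le_1: "\<alpha> \<le> 1"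
    and a_nonneg: "\<And>k. k \<in> {1..K} \<Longrightarrow> 0 \<le> a k"
    and sum_a: "(\<Sum>k=1..K. a k) = 1"
    and p_prob: "\<And>k. k \<in> {1..K} \<Longrightarrow> 0 < p k \<and> p k \<le> 1"
    and \<beta>_prob: "\<And>k. k \<in> {1..K} \<Longrightarrow> 0 < \<beta> k \<and> \<beta> k \<le> 1"
begin

abbreviation S :: "(nat \<Rightarrow> nat) set" where "S \<equiv> states N K"

abbreviation M :: "(nat \<Rightarrow> nat) \<Rightarrow> (nat \<Rightarrow> nat) pmf" where "M \<equiv> step N K \<alpha> a p \<beta>"

lemma finite_states: "finite S"
  by (simp add: states_def finite_PiE)

lemma state_le: "x \<in> S \<Longrightarrow> i \<in> {1..N} \<Longrightarrow> x i \<le> K"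
  by (auto simp: states_def)

lemma set_arrival_pmf:
  "c \<in> set_pmf (arrival_pmf K \<alpha> a) \<longleftrightarrow>
     (c = 0 \<and> \<alpha> < 1) \<or> (c \<in> {1..K} \<and> 0 < \<alpha> \<and> 0 < a c)"
proof -
  have "c \<in> set_pmf (arrival_pmf K \<alpha> a) \<longleftrightarrow>
      (\<exists>b. b \<in> set_pmf (bernoulli_pmf \<alpha>) \<and>
        c \<in> set_pmf (if b then type_pmf K a else return_pmf 0))"
    unfolding arrival_pmf_def set_bind_pmf by blast
  also have "\<dots> \<longleftrightarrow> (c = 0 \<and> \<alpha> < 1) \<or> (c \<in> {1..K} \<and> 0 < \<alpha> \<and> 0 < a c)"
    unfolding set_bernoulli_pmf_iff[OF \<alpha>_nonneg \<alpha>_le_1] ex_bool_eq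
    using set_type_pmf[of K a] a_nonneg sum_a by auto
  finally show ?thesis .
qed

lemma move_prob_bounds:
  assumes "x \<in> S" "i \<in> {1..N}"
  shows "0 \<le> move_prob N p \<beta> x i" "move_prob N p \<beta> x i \<le> 1"
proof -
  have "x i \<in> {1..K}" if "x i \<noteq> 0"
    using state_le[OF assms] that by auto
  then show "0 \<le> move_prob N p \<beta> x i" "move_prob N p \<beta> x i \<le> 1"
    using p_prob[of "x i"] \<beta>_prob[of "x i"] by (auto simp: move_prob_def)
qed

lemma update_in_states:
  assumes "x \<in> S" "c \<le> K"
  shows "update N x c m \<in> S"
proof -
  have "update N x c m i \<in> {0..K}" if "i \<in> {1..N}" for i
    using state_le[OF \<open>x \<in> S\<close>, of i] state_le[OF \<open>x \<in> S\<close>, of "i - 1"] that assms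
    by (cases "i = 1") (auto simp: update_def Suc_le_eq)
  then show ?thesis
    by (auto simp: states_def update_def PiE_iff extensional_def)
qed

lemma set_step_subset: "x \<in> S \<Longrightarrow> set_pmf (M x) \<subseteq> S"
  by (auto simp: step_def set_arrival_pmf intro!: update_in_states)

text \<open>By independence, a pattern of moves is possible once each single decision is; off
  \<open>{1..N}\<close> it must take the default \<open>False\<close> of
  \<open>Pi_pmf\<close>.\<close>

lemma update_in_set_step:
  assumes "x \<in> S" "c \<in> set_pmf (arrival_pmf K \<alpha> a)"
    and "\<And>i. i \<in> {1..N} \<Longrightarrow> if m i then 0 < move_prob N p \<beta> x i else move_prob N p \<beta> x i < 1"
    and "\<And>i. i \<notin> {1..N} \<Longrightarrow> \<not> m i"
  shows "update N x c m \<in> set_pmf (M x)"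
proof -
  have "m i \<in> set_pmf (bernoulli_pmf (move_prob N p \<beta> x i))" if "i \<in> {1..N}" for i
    using assms(3)[OF that] set_bernoulli_pmf_iff[OF move_prob_bounds[OF assms(1) that]] by blast
  then have "m \<in> PiE_dflt {1..N} False (\<lambda>i. set_pmf (bernoulli_pmf (move_prob N p \<beta> x i)))"
    using assms(4) by (auto simp: PiE_dflt_def)
  then have "m \<in> set_pmf (Pi_pmf {1..N} False (\<lambda>i. bernoulli_pmf (move_prob N p \<beta> x i)))"
    by (subst set_Pi_pmf) (auto simp: comp_def)
  with assms(2) show ?thesis
    by (auto simp: step_def)
qed

end

section \<open>Driving the process to a held state\<close>

text \<open>Every particle that can move does so, except the one in cell \<open>g\<close>; the choice
  \<open>g = 0\<close> lets all particles move.\<close>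

definition gated_moves :: "nat \<Rightarrow> nat \<Rightarrow> (nat \<Rightarrow> nat) \<Rightarrow> nat \<Rightarrow> bool" where
  "gated_moves N g x i \<longleftrightarrow>
     i \<in> {1..N} \<and> i \<noteq> g \<and> x i \<noteq> 0 \<and> (i = N \<or> x (i + 1) = 0)"

text \<open>The number of particles crossing from cell \<open>i\<close> to cell \<open>i + 1\<close>, where cells \<open>0\<close> and
  \<open>N + 1\<close> stand for the outside.\<close>

definition flow :: "nat \<Rightarrow> nat \<Rightarrow> nat \<Rightarrow> (nat \<Rightarrow> nat) \<Rightarrow> nat \<Rightarrow> int" where
  "flow N g c x i =
     of_bool (if i = 0 then x 1 = 0 \<and> c \<noteq> 0 else gated_moves N g x i)"

text \<open>A potential that ignores types; for suitable \<open>w\<close> it serves as a termination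
  measure.\<close>

definition weight :: "nat \<Rightarrow> (nat \<Rightarrow> int) \<Rightarrow> (nat \<Rightarrow> nat) \<Rightarrow> int" where
  "weight N w x = (\<Sum>i=1..N. w i * of_bool (x i \<noteq> 0))"

section \<open>Balance of occupation and weight\<close>

lemma flow_nonneg: "0 \<le> flow N g c x i"
  by (simp add: flow_def)

text \<open>Departures need an occupied cell and arrivals a vacant one, so no cell sees both in one
  step.\<close>

lemma occupied_update:
  assumes "i \<in> {1..N}"
  shows "(of_bool (update N x c (gated_moves N g x) i \<noteq> 0) :: int)
    = of_bool (x i \<noteq> 0) - flow N g c x i + flow N g c x (i - 1)"
  using assms by (cases "i = 1") (auto simp: update_def flow_def gated_moves_def)

text \<open>Summation by parts; the two zero weights absorb the outside at either end.\<close>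

lemma weight_update:
  assumes "w 0 = 0" "w (Suc N) = 0"
  shows "weight N w (update N x c (gated_moves N g x))
    = weight N w x + (\<Sum>i\<le>N. flow N g c x i * (w (Suc i) - w i))"
proof -
  let ?f = "flow N g c x"
  have shift: "(\<Sum>i=1..N. w i * ?f (i - 1)) = (\<Sum>i\<le>N. w (Suc i) * ?f i)"
  proof -
    have "(\<Sum>i=1..N. w i * ?f (i - 1)) = (\<Sum>i<N. w (Suc i) * ?f i)"
      by (rule sum.reindex_bij_witness[of _ Suc "\<lambda>i. i - 1"]) auto
    then show ?thesis
      using assms by (simp add: lessThan_Suc_atMost[symmetric])
  qed
  have drop0: "(\<Sum>i=1..N. w i * ?f i) = (\<Sum>i\<le>N. w i * ?f i)"
    using assms by (intro sum.mono_neutral_left) (auto simp: not_less_eq_eq)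
  have "weight N w (update N x c (gated_moves N g x))
      = (\<Sum>i=1..N. w i * (of_bool (x i \<noteq> 0) - ?f i + ?f (i - 1)))"
    unfolding weight_def by (intro sum.cong refl) (simp only: occupied_update)
  also have "\<dots> = weight N w x - (\<Sum>i=1..N. w i * ?f i) + (\<Sum>i=1..N. w i * ?f (i - 1))"
    by (simp add: weight_def algebra_simps sum.distrib sum_subtractf)
  finally show ?thesis
    unfolding shift drop0 by (simp add: algebra_simps sum_subtractf)
qed

text \<open>Cell \<open>L\<close> acts as a gate that stays closed with positive probability; closing gate 0
  means that nothing arrives. The choice of \<open>L\<close> and \<open>c\<close> depends on which source of randomness
  is available: \<open>L = c = 0\<close> if \<open>\<alpha> < 1\<close>, \<open>L = N\<close> if \<open>\<beta> c < 1\<close>, and \<open>L = N - 1\<close> if \<open>p c < 1\<close>.\<close>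

locale held_state = exclusion_process +
  fixes c L :: nat
  assumes c_arrival: "c \<in> set_pmf (arrival_pmf K \<alpha> a)"
    and L_le: "L \<le> N"
    and L_0_iff: "L = 0 \<longleftrightarrow> c = 0"
    and c_held: "L \<noteq> 0 \<Longrightarrow> if L = N then \<beta> c < 1 else p c < 1"
begin

definition z :: "nat \<Rightarrow> nat" where
  "z = (\<lambda>i\<in>{1..N}. if i \<le> L then c else 0)"

abbreviation succ :: "nat \<Rightarrow> (nat \<Rightarrow> nat) \<Rightarrow> nat \<Rightarrow> nat" where
  "succ g x \<equiv> update N x c (gated_moves N g x)"

abbreviation R :: "((nat \<Rightarrow> nat) \<times> (nat \<Rightarrow> nat)) set" where
  "R \<equiv> {(u, v). v \<in> set_pmf (M u)}"

text \<open>\<open>c_held\<close> speaks of type \<open>c\<close> only, so a nonzero gate is closed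
  only in such states.\<close>

definition monotype :: "(nat \<Rightarrow> nat) \<Rightarrow> bool" where
  "monotype x \<longleftrightarrow> (\<forall>i\<in>{1..N}. x i \<in> {0, c})"

lemma c_le: "c \<le> K"
  using c_arrival by (auto simp: set_arrival_pmf)

lemma succ_in_states: "x \<in> S \<Longrightarrow> succ g x \<in> S"
  by (rule update_in_states[OF _ c_le])

lemma succ_cases:
  assumes "i \<in> {1..N}"
  shows "succ g x i \<in> {0, c, x i} \<or> (1 < i \<and> succ g x i = x (i - 1))"
  using assms by (auto simp: update_def)

text \<open>Moves have positive probability because \<open>p\<close> and \<open>\<beta>\<close> do.
  A cell that sends nothing is vacant, blocked, or the gate.\<close>

lemma succ_reachable:
  assumes "x \<in> S" and "g = 0 \<or> (g = L \<and> monotype x)"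
  shows "(x, succ g x) \<in> R"
proof -
  have "if gated_moves N g x i then 0 < move_prob N p \<beta> x i else move_prob N p \<beta> x i < 1"
    if i: "i \<in> {1..N}" for i
  proof (cases "gated_moves N g x i")
    case True
    then have "x i \<in> {1..K}"
      using state_le[OF assms(1) i] by (auto simp: gated_moves_def)
    with True show ?thesis
      using p_prob[of "x i"] \<beta>_prob[of "x i"] by (auto simp: gated_moves_def move_prob_def)
  next
    case False
    show ?thesis
    proof (cases "i = g")
      case True
      \<comment> \<open>As \<open>i \<ge> 1\<close>, the gate \<open>g\<close> is not 0, which
        leaves the case \<open>g = L\<close>.\<close>
      with i assms have "i = L" "L \<noteq> 0" "x i \<in> {0, c}"
        by (auto simp: monotype_def)
      with False c_held show ?thesis
        by (auto simp: move_prob_def split: if_splits)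
    next
      case neq: False
      with False i show ?thesis
        by (auto simp: gated_moves_def move_prob_def)
    qed
  qed
  then have "succ g x \<in> set_pmf (M x)"
    by (intro update_in_set_step assms(1) c_arrival) (auto simp: gated_moves_def)
  then show ?thesis by simp
qed

text \<open>With all particles moving and only type \<open>c\<close> arriving, consider the hindmost particle of
  another type: the total distance to the exit of this particle and all those ahead of it
  decreases, as the front particle always moves and nothing enters the group from behind.\<close>

lemma reach_monotype:
  assumes "x \<in> S" "\<And>i. i \<in> {1..<j} \<Longrightarrow> x i \<in> {0, c}"
  shows "\<exists>y\<in>S. monotype y \<and> (x, y) \<in> R\<^sup>*"
  using assms
proof (induction "nat (weight N (\<lambda>i. if i < j then 0 else int N + 1 - int i) x)"
    arbitrary: x j rule: less_induct)
  case (less x j)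
  show ?case
  proof (cases "monotype x")
    case True
    then show ?thesis using less.prems by blast
  next
    case False
    define k where "k = (LEAST i. i \<in> {1..N} \<and> x i \<notin> {0, c})"
    have k: "k \<in> {1..N}" "x k \<notin> {0, c}"
      using LeastI_ex[of "\<lambda>i. i \<in> {1..N} \<and> x i \<notin> {0, c}"] False
      unfolding k_def[symmetric] monotype_def by blast+
    have below_k: "x i \<in> {0, c}" if "i \<in> {1..<k}" for i
      using not_less_Least[of i "\<lambda>i. i \<in> {1..N} \<and> x i \<notin> {0, c}"] that k(1)
      unfolding k_def[symmetric] by auto
    have "j \<le> k"
      using less.prems(2)[of k] k by force
    let ?w = "\<lambda>j i. if i < j then 0 else int N + 1 - int i"
    let ?y = "succ 0 x"
    have nonneg: "0 \<le> weight N (?w k) v" for v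
      unfolding weight_def by (intro sum_nonneg) auto
    \<comment> \<open>Raising \<open>j\<close> to \<open>k\<close> only drops nonnegative
      terms.\<close>
    have "weight N (?w k) x \<le> weight N (?w j) x"
      unfolding weight_def using \<open>j \<le> k\<close> by (intro sum_mono) auto
    moreover have "weight N (?w k) ?y < weight N (?w k) x"
    proof -
      define f where "f = Max {i \<in> {1..N}. x i \<noteq> 0}"
      have ne: "k \<in> {i \<in> {1..N}. x i \<noteq> 0}" using k by auto
      have f: "f \<in> {i \<in> {1..N}. x i \<noteq> 0}"
        unfolding f_def by (rule Max_in) (use ne in auto)
      have "k \<le> f"
        unfolding f_def by (rule Max_ge) (use ne in auto)
      have "f = N \<or> x (f + 1) = 0"
      proof (rule ccontr)
        assume "\<not> (f = N \<or> x (f + 1) = 0)"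
        then have "f + 1 \<in> {i \<in> {1..N}. x i \<noteq> 0}" using f by auto
        then have "f + 1 \<le> f" unfolding f_def by (intro Max_ge) auto
        then show False by simp
      qed
      then have "flow N 0 c x f = 1"
        using f by (auto simp: flow_def gated_moves_def)
      \<comment> \<open>The occupied cell \<open>k\<close> admits nothing from behind, nor from
        outside if \<open>k = 1\<close>. This is the only boundary where the weight
        increases.\<close>
      moreover have blocked: "flow N 0 c x i = 0" if "Suc i = k" for i
        using k that by (auto simp: flow_def gated_moves_def)
      have "(\<Sum>i\<le>N. flow N 0 c x i * (?w k (Suc i) - ?w k i)) < (\<Sum>i\<le>N. 0)"
      proof (rule sum_strict_mono_ex1)
        show "\<forall>i\<in>{..N}. flow N 0 c x i * (?w k (Suc i) - ?w k i) \<le> 0"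
        proof
          fix i
          consider "Suc i < k" | "Suc i = k" | "k \<le> i" by linarith
          then show "flow N 0 c x i * (?w k (Suc i) - ?w k i) \<le> 0"
            by cases (use blocked flow_nonneg[of N 0 c x i] in auto)
        qed
        show "\<exists>i\<in>{..N}. flow N 0 c x i * (?w k (Suc i) - ?w k i) < 0"
          using f \<open>k \<le> f\<close> \<open>flow N 0 c x f = 1\<close> by (intro bexI[of _ f]) auto
      qed simp
      then show ?thesis
        using k by (subst weight_update) auto
    qed
    ultimately have "nat (weight N (?w k) ?y) < nat (weight N (?w j) x)"
      using nonneg[of ?y] by linarith
    moreover have "?y \<in> S" using less.prems(1) by (rule succ_in_states)
    \<comment> \<open>Behind \<open>k\<close>, cells receive only from cells behind \<open>k\<close>
      or from outside, so \<open>k\<close> can replace \<open>j\<close>.\<close>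
    moreover have "?y i \<in> {0, c}" if "i \<in> {1..<k}" for i
      using succ_cases[of i x 0] below_k[of i] below_k[of "i - 1"] that k(1) by force
    ultimately obtain v where "v \<in> S" "monotype v" "(?y, v) \<in> R\<^sup>*"
      using less.hyps by blast
    moreover have "(x, ?y) \<in> R"
      using succ_reachable[of x 0] less.prems(1) by blast
    ultimately show ?thesis
      by (meson converse_rtrancl_into_rtrancl)
  qed
qed

text \<open>Up to the gate, occupation propagates forward from cell 1; beyond the gate, vacancy
  propagates backward from cell \<open>N\<close>.\<close>

lemma no_flow_imp_eq_z:
  assumes "x \<in> S" "monotype x" and still: "\<And>i. i \<le> N \<Longrightarrow> flow N L c x i = 0"
  shows "x = z"
proof -
  have still': "\<not> gated_moves N L x i" for i
    using still[of i] by (cases "i \<in> {1..N}") (auto simp: flow_def gated_moves_def)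
  have behind: "x i \<noteq> 0" if "1 \<le> i" "i \<le> L" for i
    using that
  proof (induction i rule: dec_induct)
    \<comment> \<open>Here \<open>L \<ge> 1\<close>, so \<open>c \<noteq> 0\<close> and only an
      occupied cell 1 prevents an arrival.\<close>
    case base
    then show ?case using still[of 0] L_0_iff by (auto simp: flow_def)
  next
    case (step n)
    then show ?case using still'[of n] L_le by (auto simp: gated_moves_def)
  qed
  have ahead: "x i = 0" if "i \<le> N" "L < i" for i
    using that
  proof (induction i rule: inc_induct)
    case base
    then show ?case using still'[of N] by (auto simp: gated_moves_def)
  next
    case (step n)
    then show ?case using still'[of n] by (auto simp: gated_moves_def)
  qed
  show ?thesis
  proof
    fix i
    show "x i = z i"
    proof (cases "i \<in> {1..N}")
      case True
      then have "x i \<in> {0, c}" using assms(2) by (simp add: monotype_def)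
      with True show ?thesis
        using behind[of i] ahead[of i] by (auto simp: z_def)
    next
      case False
      then show ?thesis
        using assms(1) by (auto simp: z_def states_def PiE_def extensional_def)
    qed
  qed
qed

text \<open>For \<open>L = 0\<close> the boundary is closed because \<open>c = 0\<close>.\<close>

lemma flow_gate: "flow N L c x L = 0"
  using L_0_iff by (auto simp: flow_def gated_moves_def)

lemma monotype_succ:
  assumes "monotype x"
  shows "monotype (succ g x)"
  unfolding monotype_def
proof
  fix i assume "i \<in> {1..N}"
  then show "succ g x i \<in> {0, c}"
    using succ_cases[of i x g] assms[unfolded monotype_def, rule_format, of i]
      assms[unfolded monotype_def, rule_format, of "i - 1"] by fastforce
qed

text \<open>The weights drop by 1 across every boundary except the closed gate, so the weight of the
  state decreases by the number of moves.\<close>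

lemma monotype_reach_z:
  assumes "x \<in> S" "monotype x"
  shows "(x, z) \<in> R\<^sup>*"
proof -
  \<comment> \<open>The upward jump by \<open>N\<close> at the closed gate allows slope -1 elsewhere
    although \<open>w\<close> vanishes at 0 and \<open>N + 1\<close>.\<close>
  define w where "w i = (if i \<le> L then - int i else int N + 1 - int i)" for i
  have w_ge: "- int (N * N) \<le> weight N w v" for v
  proof -
    have "(\<Sum>i=1..N. - int N) \<le> weight N w v"
      unfolding weight_def by (intro sum_mono) (auto simp: w_def)
    then show ?thesis by simp
  qed
  show ?thesis
    using assms
  proof (induction "nat (weight N w x + int (N * N))" arbitrary: x rule: less_induct)
    case (less x)
    show ?case
    proof (cases "x = z")
      case False
      let ?y = "succ L x"
      obtain f where f: "f \<le> N" "flow N L c x f \<noteq> 0"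
        using no_flow_imp_eq_z[OF less.prems] False by blast
      have diff: "flow N L c x i * (w (Suc i) - w i) = - flow N L c x i" for i
        using flow_gate[of x] by (cases "i = L") (auto simp: w_def)
      have "weight N w ?y = weight N w x + (\<Sum>i\<le>N. flow N L c x i * (w (Suc i) - w i))"
        using L_le by (intro weight_update) (auto simp: w_def)
      also have "\<dots> = weight N w x - (\<Sum>i\<le>N. flow N L c x i)"
        by (simp add: diff sum_negf)
      also have "\<dots> < weight N w x"
        using f flow_nonneg[of N L c x] sum_pos2[of "{..N}" f "flow N L c x"]
        by (simp add: order_less_le)
      finally have "nat (weight N w ?y + int (N * N)) < nat (weight N w x + int (N * N))"
        using w_ge[of ?y] by linarith
      then have "(?y, z) \<in> R\<^sup>*"
        using less.hyps succ_in_states monotype_succ less.prems by blast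
      moreover have "(x, ?y) \<in> R"
        using succ_reachable[of x L] less.prems by blast
      ultimately show ?thesis
        by (meson converse_rtrancl_into_rtrancl)
    qed simp
  qed
qed

lemma z_in_states: "z \<in> S"
  using c_le by (auto simp: z_def states_def)

text \<open>With the gate closed nothing moves: the cells behind it block each other, and arrivals
  are blocked by cell 1 or absent.\<close>

lemma z_loop: "z \<in> set_pmf (M z)"
proof -
  have mono: "monotype z" by (auto simp: monotype_def z_def)
  have "succ L z = z"
  proof (rule ext)
    fix i
    show "succ L z i = z i"
      using L_0_iff L_le N_pos
      by (cases "i = 1") (auto simp: update_def z_def gated_moves_def)
  qed
  then show ?thesis
    using succ_reachable[of z L] z_in_states mono by simp
qed

lemma ergodic: "ergodic_chain S M"
proof (rule ergodic_chain_reachable_loop[where z = z])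
  show "finite S" "z \<in> S" "z \<in> set_pmf (M z)" "\<And>x. x \<in> S \<Longrightarrow> set_pmf (M x) \<subseteq> S"
    by (fact finite_states z_in_states z_loop set_step_subset)+
next
  fix x assume "x \<in> S"
  then obtain y where "y \<in> S" "monotype y" "(x, y) \<in> R\<^sup>*"
    \<comment> \<open>For \<open>j = 0\<close> the premise on the cells behind \<open>j\<close> is
      vacuous.\<close>
    using reach_monotype[of x 0] by auto
  then show "(x, z) \<in> R\<^sup>*"
    using monotype_reach_z by (meson rtrancl_trans)
qed

end

theorem theorem1:
  fixes N K :: nat and \<alpha> :: real and a p \<beta> :: "nat \<Rightarrow> real"
  assumes "N \<ge> 1" and "K \<ge> 1"
    and "0 \<le> \<alpha>" and "\<alpha> \<le> 1"
    and "\<And>k. k \<in> {1..K} \<Longrightarrow> 0 \<le> a k"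
    and "(\<Sum>k=1..K. a k) = 1"
    and "\<And>k. k \<in> {1..K} \<Longrightarrow> 0 < p k \<and> p k \<le> 1"
    and "\<And>k. k \<in> {1..K} \<Longrightarrow> 0 < \<beta> k \<and> \<beta> k \<le> 1"
    and not_deterministic:
      "\<alpha> < 1 \<or> (\<exists>k\<in>{1..K}. 0 < a k \<and> (\<beta> k < 1 \<or> (N \<ge> 2 \<and> p k < 1)))"
  shows "ergodic_chain (states N K) (step N K \<alpha> a p \<beta>)"
proof -
  interpret exclusion_process N K \<alpha> a p \<beta>
    using assms by unfold_locales auto
  show ?thesis
  proof (cases "\<alpha> < 1")
    case True
    interpret held_state N K \<alpha> a p \<beta> 0 0
      using True by unfold_locales (auto simp: set_arrival_pmf)
    show ?thesis by (rule ergodic)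
  next
    case False
    with assms(4) not_deterministic obtain k
      where k: "\<alpha> = 1" "k \<in> {1..K}" "0 < a k" "\<beta> k < 1 \<or> (N \<ge> 2 \<and> p k < 1)"
      by auto
    have c: "k \<in> set_pmf (arrival_pmf K \<alpha> a)"
      unfolding set_arrival_pmf using k by simp
    show ?thesis
    proof (cases "\<beta> k < 1")
      case True
      interpret held_state N K \<alpha> a p \<beta> k N
        using True k c assms(1) by unfold_locales auto
      show ?thesis by (rule ergodic)
    next
      case False
      \<comment> \<open>What remains is \<open>N \<ge> 2\<close> and \<open>p k < 1\<close>, so the
        gate \<open>N - 1\<close> is a genuine cell.\<close>
      interpret held_state N K \<alpha> a p \<beta> k "N - 1"
        using False k c by unfold_locales auto
      show ?thesis by (rule ergodic)
    qed
  qed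
qed

end
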